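(* Let $n\ge0$ be an integer and $\nu>0$. The matrix entries of $R(x,n)$ are multiples of scalar Laguerre polynomials: there are constants $\xi(n,i,j)$ such that for all $1\le i,j\le N$ $$R(x,n)_{i,j}=\begin{cases}L^{(\nu+j)}_{n+i-j}(x)\,\xi(n,i,j)&\text{if } n+i-j\ge0,\\ 0&\text{if } n+i-j<0.\end{cases}$$
   Context: Let $N\ge1$, let $a_1,\dots,a_{N-1}$ be real, let $E_{i,j}$ be the matrix units, and put $J=\sum_{k=1}^NkE_{k,k}$, $A=\sum_{k=1}^{N-1}a_kE_{k+1,k}$. Let $\delta_1^{(\nu)},\dots,\delta_N^{(\nu)}>0$ and $$W^{(\nu)}(x)=e^{Ax}\,T^{(\nu)}(x)\,e^{A^*x},\qquad T^{(\nu)}(x)=e^{-x}\sum_{k=1}^N\delta_k^{(\nu)}x^{\nu+k}E_{k,k},\qquad x\in[0,\infty).$$ Let $(P(x,n))_{n\ge0}$ be the unique sequence of monic polynomials of degree $n$ in $M_N(\mathbb{C})[x]$ orthogonal with respect to $\langle P,Q\rangle=\int_0^\infty P(x)W^{(\nu)}(x)Q(x)^*\,dx$. Put $\Gamma_n=A(n+\nu+1+J)-(n+J)$ and $\Lambda_n=-(n+J)$ (scalars denote multiples of the identity), and let $K_n$ be the unique lower triangular matrix with ones on the diagonal such that $\Gamma_n=K_n\Lambda_nK_n^{-1}$. Define $R(x,n)=K_n^{-1}P(x,n)e^{xA}$. $L^{(\alpha)}_m$ denotes the generalized Laguerre polynomial of degree $m$, with $L_m^{(\alpha)}(0)=(\alpha+1)_m/m!$.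 *)

theory Defs
  imports
    "HOL-Analysis.Set_Integral"
    "HOL-Analysis.Lebesgue_Measure"
    "HOL-Computational_Algebra.Polynomial"
    "Jordan_Normal_Form.Matrix"
    "Jordan_Normal_Form.Gauss_Jordan_Elimination"
    "Jordan_Normal_Form.Schur_Decomposition"
begin

text \<open>
  Matrices carry the library's indices \<open>0, \<dots>, N - 1\<close>. The data \<open>a\<close>, \<open>\<delta>\<close> and the numbers entering
  \<open>J\<close> are indexed from 1, so entry \<open>(i, j)\<close> in the usual numbering is \<open>$$ (i - 1, j - 1)\<close>.
\<close>

definition J_mat :: "nat \<Rightarrow> complex mat" where
  "J_mat N = mat_diag N (\<lambda>k. of_nat (k + 1))"

text \<open>The unit \<open>E\<^bsub>k+1,k\<^esub>\<close> sits at position \<open>(k, k - 1)\<close> in the library's numbering.\<close>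

definition A_mat :: "nat \<Rightarrow> (nat \<Rightarrow> real) \<Rightarrow> complex mat" where
  "A_mat N a = mat N N (\<lambda>(r, c). if r = c + 1 then of_real (a r) else 0)"

definition scalar_mat :: "nat \<Rightarrow> complex \<Rightarrow> complex mat" where
  "scalar_mat N c = c \<cdot>\<^sub>m 1\<^sub>m N"

text \<open>The exponential series, summed entrywise (there is no topology on the type of matrices).\<close>

definition mat_exp :: "complex mat \<Rightarrow> complex mat" where
  "mat_exp M = mat (dim_row M) (dim_row M) (\<lambda>(i, j). \<Sum>k. (M ^\<^sub>m k) $$ (i, j) / fact k)"

definition T_weight :: "nat \<Rightarrow> real \<Rightarrow> (nat \<Rightarrow> real) \<Rightarrow> real \<Rightarrow> complex mat" where
  "T_weight N \<nu> \<delta> x =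
     mat_diag N (\<lambda>k. of_real (exp (- x) * (\<delta> (k + 1) * x powr (\<nu> + real (k + 1)))))"

definition W_weight :: "nat \<Rightarrow> (nat \<Rightarrow> real) \<Rightarrow> real \<Rightarrow> (nat \<Rightarrow> real) \<Rightarrow> real \<Rightarrow> complex mat" where
  "W_weight N a \<nu> \<delta> x =
     mat_exp (of_real x \<cdot>\<^sub>m A_mat N a) * T_weight N \<nu> \<delta> x
       * mat_exp (of_real x \<cdot>\<^sub>m mat_adjoint (A_mat N a))"

text \<open>Matrix polynomials are represented as matrices with polynomial entries.\<close>

definition eval_mat :: "complex poly mat \<Rightarrow> real \<Rightarrow> complex mat" where
  "eval_mat P x = map_mat (\<lambda>p. poly p (of_real x)) P"

definition monic_of_degree :: "nat \<Rightarrow> nat \<Rightarrow> complex poly mat \<Rightarrow> bool" where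
  "monic_of_degree N n P \<longleftrightarrow>
     P \<in> carrier_mat N N \<and>
     (\<forall>i<N. \<forall>j<N. degree (P $$ (i, j)) \<le> n) \<and>
     map_mat (\<lambda>p. coeff p n) P = 1\<^sub>m N"

definition W_inner ::
  "nat \<Rightarrow> (nat \<Rightarrow> real) \<Rightarrow> real \<Rightarrow> (nat \<Rightarrow> real) \<Rightarrow> complex poly mat \<Rightarrow> complex poly mat \<Rightarrow> complex mat" where
  "W_inner N a \<nu> \<delta> P Q =
     mat N N (\<lambda>(i, j). LINT x:{0..}|lborel.
       (eval_mat P x * W_weight N a \<nu> \<delta> x * mat_adjoint (eval_mat Q x)) $$ (i, j))"

definition monic_orthogonal ::
  "nat \<Rightarrow> (nat \<Rightarrow> real) \<Rightarrow> real \<Rightarrow> (nat \<Rightarrow> real) \<Rightarrow> (nat \<Rightarrow> complex poly mat) \<Rightarrow> bool" where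
  "monic_orthogonal N a \<nu> \<delta> P \<longleftrightarrow>
     (\<forall>n. monic_of_degree N n (P n)) \<and>
     (\<forall>m n. m \<noteq> n \<longrightarrow> W_inner N a \<nu> \<delta> (P m) (P n) = 0\<^sub>m N N)"

definition Gamma_mat :: "nat \<Rightarrow> (nat \<Rightarrow> real) \<Rightarrow> real \<Rightarrow> nat \<Rightarrow> complex mat" where
  "Gamma_mat N a \<nu> n =
     A_mat N a * (scalar_mat N (of_real (real n + \<nu> + 1)) + J_mat N)
       - (scalar_mat N (of_nat n) + J_mat N)"

definition Lambda_mat :: "nat \<Rightarrow> nat \<Rightarrow> complex mat" where
  "Lambda_mat N n = - (scalar_mat N (of_nat n) + J_mat N)"

definition mat_inv :: "complex mat \<Rightarrow> complex mat" where
  "mat_inv M = the (mat_inverse M)"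

definition unit_lower_triangular :: "nat \<Rightarrow> complex mat \<Rightarrow> bool" where
  "unit_lower_triangular N K \<longleftrightarrow>
     K \<in> carrier_mat N N \<and>
     (\<forall>i<N. K $$ (i, i) = 1) \<and>
     (\<forall>i j. i < j \<longrightarrow> j < N \<longrightarrow> K $$ (i, j) = 0)"

definition diagonalizes_Gamma ::
  "nat \<Rightarrow> (nat \<Rightarrow> real) \<Rightarrow> real \<Rightarrow> nat \<Rightarrow> complex mat \<Rightarrow> bool" where
  "diagonalizes_Gamma N a \<nu> n K \<longleftrightarrow>
     unit_lower_triangular N K \<and>
     Gamma_mat N a \<nu> n = K * Lambda_mat N n * mat_inv K"

definition R_mat ::
  "nat \<Rightarrow> (nat \<Rightarrow> real) \<Rightarrow> complex mat \<Rightarrow> complex poly mat \<Rightarrow> real \<Rightarrow> complex mat" where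
  "R_mat N a K P x = mat_inv K * eval_mat P x * mat_exp (of_real x \<cdot>\<^sub>m A_mat N a)"

definition laguerre :: "nat \<Rightarrow> real \<Rightarrow> real poly" where
  "laguerre m \<alpha> =
     (\<Sum>k\<le>m. monom ((- 1) ^ k / fact k * ((real m + \<alpha>) gchoose (m - k))) k)"

lemma laguerre_at_0: "poly (laguerre m \<alpha>) 0 = pochhammer (\<alpha> + 1) m / fact m"
proof -
  have "poly (laguerre m \<alpha>) 0 =
      (\<Sum>k\<le>m. if k = 0 then (real m + \<alpha>) gchoose m else 0)"
    unfolding laguerre_def poly_sum by (intro sum.cong) (auto simp: poly_monom)
  also have "\<dots> = (real m + \<alpha>) gchoose m" by simp
  finally show ?thesis
    by (simp add: gbinomial_pochhammer' add.commute)
qed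

end

theory Submission
  imports Defs "HOL-Analysis.Gamma_Function"
begin

text \<open>
  For a polynomial row vector \<open>p\<close>, put \<open>q = p e^{xA}\<close>. In terms of \<open>q\<close> the weight is the diagonal matrix
  \<open>T\<close>, whose entries are scalar Laguerre weights \<open>x powr (\<nu> + j) * exp (- x)\<close>. The scalar Laguerre
  operators, put on the diagonal and shifted by \<open>- J\<close>, form an operator \<open>D\<close> that is symmetric for this
  weight (lemma \<open>diag_op_symmetric\<close>).

  The choice of \<open>J\<close> and \<open>A\<close> enters through \<open>[J, A] = A\<close>. It implies that \<open>D\<close>, conjugated back to the
  rows \<open>p\<close>, has polynomial coefficients and does not raise the degree; on leading coefficients of rows
  of degree \<open>n\<close> it acts as right multiplication by \<open>\<Gamma>\<close> with index \<open>n\<close> (lemmas \<open>diag_op_row_exp\<close> and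
  \<open>coeff_row_op\<close>).

  Row \<open>i\<close> of \<open>R\<close> comes from a row \<open>p\<close> of degree \<open>n\<close> whose leading coefficient is row \<open>i\<close> of \<open>K\<^sup>-\<^sup>1\<close>, a left
  eigenvector of \<open>\<Gamma>\<close> with eigenvalue \<open>- (n + i)\<close>. Therefore \<open>D + n + i\<close> maps this row of \<open>R\<close> to
  something of degree below \<open>n\<close>, which by symmetry of \<open>D\<close> is orthogonal to everything of degree below
  \<open>n\<close>, itself included. So it is zero (lemma \<open>diag_op_eigenfunction\<close>): every row of \<open>R\<close> is an
  eigenfunction of \<open>D\<close>. As \<open>D\<close> is diagonal, the entry \<open>(i, j)\<close> of \<open>R\<close> solves Laguerre's equation with
  parameter \<open>\<nu> + j\<close> and eigenvalue \<open>- (n + i - j)\<close>. Its polynomial solutions are the multiples of the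
  Laguerre polynomial if \<open>n + i - j\<close> is nonnegative, and only zero otherwise (lemma
  \<open>laguerre_op_eigenfunction\<close>).
\<close>

section \<open>Integration against a scalar Laguerre weight\<close>

definition weighted_integral :: "real \<Rightarrow> complex poly \<Rightarrow> complex" where
  "weighted_integral \<alpha> f =
     (LINT x:{0..}|lborel. poly f (of_real x) * of_real (exp (- x) * x powr \<alpha>))"

lemma has_bochner_integral_Gamma:
  assumes "s > (0::real)"
  shows "has_bochner_integral lborel (\<lambda>x. indicator {0..} x * (x powr (s - 1) / exp x)) (Gamma s)"
  by (rule has_bochner_integral_nn_integral)
     (use assms Gamma_real_pos[OF assms] in \<open>auto simp: Gamma_conv_nn_integral_real mult.assoc[symmetric]\<close>)

lemma has_integral_weighted_monom:
  assumes "\<alpha> > -1"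
  shows "has_bochner_integral lborel
           (\<lambda>x. indicator {0..} x *\<^sub>R (complex_of_real x ^ k * of_real (exp (- x) * x powr \<alpha>)))
           (of_real (Gamma (\<alpha> + real k + 1)))"
proof -
  have "indicator {0..} x * (x powr (\<alpha> + real k + 1 - 1) / exp x) =
        indicator {0..} x * (x ^ k * (exp (- x) * x powr \<alpha>))" for x :: real
    by (cases "x > 0") (auto simp: powr_add powr_realpow exp_minus field_simps indicator_def)
  hence "has_bochner_integral lborel (\<lambda>x. indicator {0..} x * (x ^ k * (exp (- x) * x powr \<alpha>)))
          (Gamma (\<alpha> + real k + 1))"
    using has_bochner_integral_Gamma[of "\<alpha> + real k + 1"] assms by simp
  from has_bochner_integral_of_real[OF this, where 'a = complex]
  show ?thesis by (simp add: scaleR_conv_of_real)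
qed

lemma has_integral_weighted_poly:
  fixes f :: "complex poly"
  assumes "\<alpha> > -1"
  shows "has_bochner_integral lborel
           (\<lambda>x. indicator {0..} x *\<^sub>R (poly f (complex_of_real x) * of_real (exp (- x) * x powr \<alpha>)))
           (\<Sum>k\<le>degree f. coeff f k * of_real (Gamma (\<alpha> + real k + 1)))"
proof -
  have "has_bochner_integral lborel
      (\<lambda>x. \<Sum>k\<le>degree f. coeff f k * (indicator {0..} x *\<^sub>R
              (complex_of_real x ^ k * of_real (exp (- x) * x powr \<alpha>))))
      (\<Sum>k\<le>degree f. coeff f k * of_real (Gamma (\<alpha> + real k + 1)))"
    by (intro has_bochner_integral_sum has_bochner_integral_mult_right
          has_integral_weighted_monom assms)
  thus ?thesis
    by (simp add: poly_altdef sum_distrib_left sum_distrib_right mult_ac scaleR_conv_of_real)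
qed

lemma weighted_poly_integrable:
  assumes "\<alpha> > -1"
  shows "set_integrable lborel {0..}
           (\<lambda>x. poly f (complex_of_real x) * of_real (exp (- x) * x powr \<alpha>))"
  using has_integral_weighted_poly[OF assms, of f]
  by (simp add: set_integrable_def has_bochner_integral_iff)

lemma weighted_integral_monom:
  assumes "\<alpha> > -1"
  shows "weighted_integral \<alpha> (monom c k) = c * of_real (Gamma (\<alpha> + real k + 1))"
  using has_bochner_integral_integral_eq[OF has_bochner_integral_mult_right[OF
          has_integral_weighted_monom[OF assms, of k], of c]]
  unfolding weighted_integral_def set_lebesgue_integral_def
  by (simp add: poly_monom scaleR_conv_of_real mult_ac)

lemma weighted_integral_add:
  assumes "\<alpha> > -1"
  shows "weighted_integral \<alpha> (f + g) = weighted_integral \<alpha> f + weighted_integral \<alpha> g"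
  unfolding weighted_integral_def poly_add distrib_right
  by (intro set_integral_add weighted_poly_integrable assms)

lemma weighted_integral_smult:
  "weighted_integral \<alpha> (smult c f) = c * weighted_integral \<alpha> f"
  unfolding weighted_integral_def poly_smult mult.assoc by simp

lemma weighted_integral_diff:
  assumes "\<alpha> > -1"
  shows "weighted_integral \<alpha> (f - g) = weighted_integral \<alpha> f - weighted_integral \<alpha> g"
  using weighted_integral_add[OF assms, of f "smult (-1) g"]
  unfolding weighted_integral_smult by simp

lemma weighted_integral_sum:
  assumes "\<alpha> > -1"
  shows "weighted_integral \<alpha> (\<Sum>i\<in>I. f i) = (\<Sum>i\<in>I. weighted_integral \<alpha> (f i))"
proof -
  have "weighted_integral \<alpha> 0 = 0" by (simp add: weighted_integral_def)
  thus ?thesis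
    by (induction I rule: infinite_finite_induct) (simp_all add: weighted_integral_add[OF assms])
qed

text \<open>
  The Laguerre differential operator \<open>x f'' + (\<alpha> + 1 - x) f'\<close>, whose eigenfunction of degree \<open>m\<close>
  has eigenvalue \<open>- m\<close>.
\<close>

definition laguerre_op :: "real \<Rightarrow> complex poly \<Rightarrow> complex poly" where
  "laguerre_op \<alpha> f = [:0, 1:] * pderiv (pderiv f) + [:of_real (\<alpha> + 1), -1:] * pderiv f"

lemma coeff_laguerre_op:
  "coeff (laguerre_op \<alpha> f) k =
     of_nat (k + 1) * of_real (real k + 1 + \<alpha>) * coeff f (k + 1) - of_nat k * coeff f k"
  by (cases k) (auto simp: laguerre_op_def coeff_pderiv algebra_simps)

text \<open>
  Integration by parts without boundary terms: multiplied by the weight \<open>x powr \<alpha> * exp (- x)\<close>, the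
  integrand is the derivative of \<open>x powr (\<alpha> + 1) * exp (- x) * h\<close>, which vanishes at both ends. By
  linearity it is enough to take a monomial \<open>h\<close>, where the claim is the functional equation of
  \<open>Gamma\<close>.
\<close>

lemma weighted_integral_total_derivative:
  assumes "\<alpha> > -1"
  shows "weighted_integral \<alpha> ([:0, 1:] * pderiv h + [:of_real (\<alpha> + 1), -1:] * h) = 0"
    (is "?I h = 0")
proof -
  have monom: "?I (monom c k) = 0" for c k
  proof -
    have "[:0, 1:] * pderiv (monom c k) + [:of_real (\<alpha> + 1), -1:] * monom c k =
          monom (c * of_real (\<alpha> + real k + 1)) k - monom c (Suc k)"
      by (intro poly_eqI) (auto simp: coeff_pCons coeff_pderiv algebra_simps split: nat.split)
    \<comment> \<open>the two monomials that remain have equal integrals by the functional equation\<close>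
    moreover have "Gamma (\<alpha> + real (Suc k) + 1) = (\<alpha> + real k + 1) * Gamma (\<alpha> + real k + 1)"
      using Gamma_plus1[of "\<alpha> + real k + 1"] assms by (auto simp: nonpos_Ints_def add_ac)
    ultimately show ?thesis
      by (simp only: weighted_integral_diff[OF assms] weighted_integral_monom[OF assms]) simp
  qed
  have "?I h = ?I (\<Sum>k\<le>degree h. monom (coeff h k) k)"
    by (simp add: poly_as_sum_of_monoms)
  also have "\<dots> = (\<Sum>k\<le>degree h. ?I (monom (coeff h k) k))"
    by (simp add: higher_pderiv_sum pderiv_sum sum_distrib_left weighted_integral_add[OF assms]
       weighted_integral_sum[OF assms] sum.distrib del: mult_pCons_left)
  finally show ?thesis by (simp only: monom sum.neutral_const)
qed

text \<open>
  In Sturm--Liouville form the operator is \<open>(x w f')' / w\<close> with \<open>w = x powr \<alpha> * exp (- x)\<close>; hence the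
  difference of the two integrands is, up to the weight, the derivative of \<open>x w (f' g - f g')\<close>.
\<close>

lemma laguerre_op_symmetric:
  assumes "\<alpha> > -1"
  shows "weighted_integral \<alpha> (laguerre_op \<alpha> f * g) = weighted_integral \<alpha> (f * laguerre_op \<alpha> g)"
proof -
  have "laguerre_op \<alpha> f * g - f * laguerre_op \<alpha> g =
        [:0, 1:] * pderiv (pderiv f * g - f * pderiv g)
        + [:of_real (\<alpha> + 1), -1:] * (pderiv f * g - f * pderiv g)"
    unfolding laguerre_op_def pderiv_mult pderiv_diff
    by (simp only: distrib_left distrib_right left_diff_distrib right_diff_distrib mult_ac) simp
  thus ?thesis
    using weighted_integral_total_derivative[OF assms, of "pderiv f * g - f * pderiv g"]
    by (metis weighted_integral_diff[OF assms] eq_iff_diff_eq_0)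
qed

lemma weighted_integral_norm_square:
  assumes "\<alpha> > -1"
  shows "weighted_integral \<alpha> (f * map_poly cnj f) =
           of_real (LINT x:{0..}|lborel. (cmod (poly f (of_real x)))\<^sup>2 * (exp (- x) * x powr \<alpha>))"
  unfolding weighted_integral_def set_integral_complex_of_real[symmetric]
  by (simp only: of_real_mult complex_norm_square poly_mult poly_map_poly_cnj complex_cnj_complex_of_real)

text \<open>
  A vanishing integral of a nonnegative function forces the polynomial to vanish almost everywhere on
  the half-line, but a nonzero polynomial has only finitely many zeros.
\<close>

lemma weighted_integral_norm_square_eq_0:
  assumes \<alpha>: "\<alpha> > -1" and "weighted_integral \<alpha> (f * map_poly cnj f) = 0"
  shows "f = 0"
proof (rule ccontr)
  assume "f \<noteq> 0"
  let ?g = "\<lambda>x. indicator {0..} x *\<^sub>R ((cmod (poly f (complex_of_real x)))\<^sup>2 * (exp (- x) * x powr \<alpha>))"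
  have eq: "(\<lambda>x. complex_of_real (?g x)) = (\<lambda>x. indicator {0..} x *\<^sub>R
     (poly (f * map_poly cnj f) (of_real x) * of_real (exp (- x) * x powr \<alpha>)))"
    by (simp only: fun_eq_iff real_scaleR_def scaleR_conv_of_real of_real_mult complex_norm_square poly_mult
          poly_map_poly_cnj complex_cnj_complex_of_real mult.assoc) (simp add: mult_ac)
  have "integrable lborel (\<lambda>x. complex_of_real (?g x))"
    using weighted_poly_integrable[OF \<alpha>, of "f * map_poly cnj f"] unfolding set_integrable_def eq .
  hence int: "integrable lborel ?g" by (simp only: complex_of_real_integrable_eq)
  have "integral\<^sup>L lborel ?g = 0"
    using assms(2) weighted_integral_norm_square[OF \<alpha>, of f]
    by (simp add: set_lebesgue_integral_def)
  hence "AE x in lborel. ?g x = 0"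
    using integral_nonneg_eq_0_iff_AE[OF int] by simp
  moreover have "finite (complex_of_real -` {z. poly f z = 0})"
    using poly_roots_finite[OF \<open>f \<noteq> 0\<close>] by (intro finite_vimageI) (auto intro: injI)
  hence "AE x in lborel. x \<notin> complex_of_real -` {z. poly f z = 0}"
    by (intro AE_not_in finite_imp_null_set_lborel)
  \<comment> \<open>any interval of positive length inside the half-line gives the contradiction\<close>
  ultimately have "AE x::real in lborel. x \<notin> {1..2}"
    by eventually_elim (auto simp: indicator_def)
  hence "{1..2::real} \<in> null_sets lborel"
    by (subst AE_iff_null_sets) auto
  thus False by (simp add: null_sets_def)
qed

section \<open>Polynomial solutions of Laguerre's equation\<close>

lemma coeff_laguerre:
  "coeff (laguerre m \<alpha>) k =
     (if k \<le> m then (- 1) ^ k / fact k * ((real m + \<alpha>) gchoose (m - k)) else 0)"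
  by (simp add: laguerre_def coeff_sum)

text \<open>
  This is the recursion for the coefficients of a power series solution of Laguerre's equation with
  eigenvalue \<open>- m\<close>. Below the top degree it is the contiguity
  \<open>(b - j) * (b gchoose j) = Suc j * (b gchoose Suc j)\<close> with \<open>b = m + \<alpha>\<close> and \<open>j = m - k - 1\<close>; from the
  top degree on, both sides vanish.
\<close>

lemma coeff_laguerre_Suc:
  "real (k + 1) * (real k + 1 + \<alpha>) * coeff (laguerre m \<alpha>) (k + 1)
     = (real k - real m) * coeff (laguerre m \<alpha>) k"
proof (cases "k < m")
  case True
  define j where "j = m - Suc k"
  have m: "m - k = Suc j" "real m = real k + 1 + real j" using True by (simp_all add: j_def)
  define b where "b = real m + \<alpha>"
  have rec: "(b - real j) * (b gchoose j) = real (Suc j) * (b gchoose Suc j)"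
    using gbinomial_mult_1[of b j] by (simp add: algebra_simps)
  have "real (k + 1) * (real k + 1 + \<alpha>) * coeff (laguerre m \<alpha>) (k + 1)
         = real (k + 1) * ((- 1) ^ Suc k / fact (Suc k)) * ((b - real j) * (b gchoose j))"
    using True m by (simp add: coeff_laguerre j_def[symmetric] b_def del: fact_Suc)
  also have "real (k + 1) * ((- 1) ^ Suc k / fact (Suc k)) = (- 1) ^ Suc k / (fact k :: real)"
    by (simp add: fact_Suc del: of_nat_Suc)
  also have "(- 1) ^ Suc k / fact k * ((b - real j) * (b gchoose j))
               = (real k - real m) * coeff (laguerre m \<alpha>) k"
    unfolding rec using True m by (simp add: coeff_laguerre b_def algebra_simps diff_divide_distrib add_divide_distrib)
  finally show ?thesis .
qed (auto simp: coeff_laguerre)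

lemma coeff_laguerre_0:
  assumes "\<alpha> > -1"
  shows "coeff (laguerre m \<alpha>) 0 \<noteq> 0"
  using assms pochhammer_pos[of "\<alpha> + 1" m]
  by (simp add: poly_0_coeff_0[symmetric] laguerre_at_0)

text \<open>
  The eigenvalue is \<open>q - p\<close>. Comparing coefficients, an eigenfunction satisfies the same two-term
  recursion as the Laguerre polynomial of degree \<open>p - q\<close>, and for \<open>\<alpha> > -1\<close> this recursion determines
  all coefficients from the constant one. For \<open>q > p\<close> the leading coefficient would have to be
  annihilated by a positive number, so that there is no nonzero polynomial solution.
\<close>

lemma laguerre_op_eigenfunction:
  fixes f :: "complex poly"
  assumes \<alpha>: "\<alpha> > -1"
    and eigen: "laguerre_op \<alpha> f + of_nat p * f = of_nat q * f"
  shows "\<exists>c. \<forall>x::real. poly f (of_real x) =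
           (if q \<le> p then of_real (poly (laguerre (p - q) \<alpha>) x) * c else 0)"
proof -
  have rec: "of_nat (k + 1) * of_real (real k + 1 + \<alpha>) * coeff f (k + 1)
               = (of_nat k + of_nat q - of_nat p) * coeff f k" for k
    using arg_cong[OF eigen, of "\<lambda>g. coeff g k"]
    by (simp add: coeff_laguerre_op of_nat_poly algebra_simps)
  show ?thesis
  proof (cases "q \<le> p")
    case True
    define L where "L = laguerre (p - q) \<alpha>"
    define c where "c = coeff f 0 / of_real (coeff L 0)"
    have L0: "coeff L 0 \<noteq> 0" unfolding L_def by (rule coeff_laguerre_0[OF \<alpha>])
    have coeff: "coeff f k = of_real (coeff L k) * c" for k
    proof (induction k)
      case 0
      show ?case using L0 by (simp add: c_def)
    next
      case (Suc k)
      have nz: "of_nat (k + 1) * complex_of_real (real k + 1 + \<alpha>) \<noteq> 0"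
        using \<alpha> by (simp only: mult_eq_0_iff of_nat_eq_0_iff of_real_eq_0_iff) simp
      have "of_nat (k + 1) * complex_of_real (real k + 1 + \<alpha>) * of_real (coeff L (k + 1))
              = of_real (real (k + 1) * (real k + 1 + \<alpha>) * coeff L (k + 1))" by simp
      also have "\<dots> = (of_nat k + of_nat q - of_nat p) * of_real (coeff L k)"
        unfolding L_def coeff_laguerre_Suc using True by (simp add: of_nat_diff)
      finally have "of_nat (k + 1) * complex_of_real (real k + 1 + \<alpha>) * (of_real (coeff L (k + 1)) * c)
              = of_nat (k + 1) * of_real (real k + 1 + \<alpha>) * coeff f (k + 1)"
        unfolding rec Suc.IH by (simp only: mult.assoc[symmetric])
      hence "of_real (coeff L (k + 1)) * c = coeff f (k + 1)" unfolding mult_left_cancel[OF nz] .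
      thus ?case by simp
    qed
    have "f = smult c (map_poly of_real L)"
      by (intro poly_eqI) (simp add: coeff coeff_map_poly mult.commute)
    moreover have "poly (map_poly of_real L) (complex_of_real x) = of_real (poly L x)" for x
      by (simp add: poly_altdef degree_map_poly coeff_map_poly)
    ultimately show ?thesis using True by (intro exI[of _ c]) (simp add: L_def mult.commute)
  next
    case False
    have "f = 0"
    proof (rule ccontr)
      assume "f \<noteq> 0"
      hence "of_nat (degree f) + of_nat q - (of_nat p :: complex) = 0"
        using rec[of "degree f"] by (simp add: coeff_eq_0)
      hence "(of_nat (degree f + q) :: complex) = of_nat p" by simp
      thus False using False by (simp only: of_nat_eq_iff)
    qed
    thus ?thesis using False by simp
  qed
qed

section \<open>The differential operator on rows\<close>

text \<open>
  The entry \<open>(k, j)\<close> of \<open>e^{xA}\<close>, as a polynomial in \<open>x\<close>: the only path from \<open>k\<close> down to \<open>j\<close> along the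
  subdiagonal has length \<open>k - j\<close>, so that a single term of the exponential series contributes.
\<close>

definition exp_entry :: "(nat \<Rightarrow> real) \<Rightarrow> nat \<Rightarrow> nat \<Rightarrow> complex poly" where
  "exp_entry a k j =
     (if j \<le> k then monom (of_real (\<Prod>l\<in>{j<..k}. a l) / fact (k - j)) (k - j) else 0)"

lemma pderiv_exp_entry_0: "pderiv (exp_entry a 0 j) = 0"
  by (simp add: exp_entry_def pderiv_monom)

lemma pderiv_exp_entry_Suc:
  "pderiv (exp_entry a (Suc k) j) = [:of_real (a (Suc k)):] * exp_entry a k j"
proof (cases "j \<le> k")
  case True
  have "{j<..Suc k} = insert (Suc k) {j<..k}" using True by auto
  hence "(\<Prod>l\<in>{j<..Suc k}. a l) = a (Suc k) * (\<Prod>l\<in>{j<..k}. a l)" by simp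
  moreover have "fact (Suc k - j) = of_nat (Suc k - j) * (fact (k - j) :: complex)"
    using True by (simp add: Suc_diff_le)
  ultimately show ?thesis
    using True by (simp add: exp_entry_def pderiv_monom smult_monom Suc_diff_le del: of_nat_Suc)
next
  case False
  thus ?thesis by (cases "j = Suc k") (auto simp: exp_entry_def pderiv_monom)
qed

text \<open>
  Since \<open>exp_entry a k j\<close> is homogeneous of degree \<open>k - j\<close>, Euler's identity gives the entries of
  \<open>e^{xA} J = (J - x A) e^{xA}\<close>. This is the form in which the relation \<open>[J, A] = A\<close> is used.
\<close>

lemma euler_exp_entry:
  "of_nat j * exp_entry a k j = of_nat k * exp_entry a k j - [:0, 1:] * pderiv (exp_entry a k j)"
proof -
  have "[:0, 1:] * pderiv (exp_entry a k j) = of_nat (k - j) * exp_entry a k j"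
    by (cases "k - j")
       (auto simp: exp_entry_def pderiv_monom of_nat_poly smult_monom monom_Suc[symmetric] simp del: of_nat_Suc)
  thus ?thesis
    by (cases "j \<le> k") (simp_all add: exp_entry_def of_nat_diff algebra_simps)
qed

text \<open>
  A row vector of polynomials is a function on the indices below \<open>N\<close>. The maps \<open>row_exp\<close> and \<open>row_A\<close>
  are right multiplication of a row by \<open>e^{xA}\<close> and by \<open>A\<close>.
\<close>

definition row_exp :: "nat \<Rightarrow> (nat \<Rightarrow> real) \<Rightarrow> (nat \<Rightarrow> complex poly) \<Rightarrow> nat \<Rightarrow> complex poly" where
  "row_exp N a u j = (\<Sum>k<N. u k * exp_entry a k j)"

definition row_A :: "nat \<Rightarrow> (nat \<Rightarrow> real) \<Rightarrow> (nat \<Rightarrow> complex poly) \<Rightarrow> nat \<Rightarrow> complex poly" where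
  "row_A N a u k = (if Suc k < N then [:of_real (a (Suc k)):] * u (Suc k) else 0)"

lemma row_exp_add: "row_exp N a u j + row_exp N a v j = row_exp N a (\<lambda>k. u k + v k) j"
  by (simp add: row_exp_def distrib_right sum.distrib)

lemma row_exp_diff: "row_exp N a u j - row_exp N a v j = row_exp N a (\<lambda>k. u k - v k) j"
  by (simp add: row_exp_def left_diff_distrib sum_subtractf)

lemma row_exp_mult: "c * row_exp N a u j = row_exp N a (\<lambda>k. c * u k) j"
  by (simp add: row_exp_def sum_distrib_left mult_ac)

lemma row_exp_smult: "smult c (row_exp N a u j) = row_exp N a (\<lambda>k. smult c (u k)) j"
  using row_exp_mult[of "[:c:]" N a u j] by simp

lemma row_exp_sum: "(\<Sum>l\<in>I. row_exp N a (u l) j) = row_exp N a (\<lambda>k. \<Sum>l\<in>I. u l k) j"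
  unfolding row_exp_def sum_distrib_right by (rule sum.swap)

text \<open>
  Entrywise this is \<open>A e^{xA} = (e^{xA})'\<close>.
\<close>

lemma row_exp_row_A: "row_exp N a (row_A N a u) j = (\<Sum>k<N. u k * pderiv (exp_entry a k j))"
proof (cases N)
  case (Suc M)
  have "row_exp N a (row_A N a u) j = (\<Sum>k<M. row_A N a u k * exp_entry a k j)"
    by (simp add: row_exp_def Suc row_A_def)
  also have "\<dots> = (\<Sum>k<M. u (Suc k) * pderiv (exp_entry a (Suc k) j))"
    by (intro sum.cong) (auto simp: row_A_def Suc pderiv_exp_entry_Suc)
  finally show ?thesis
    unfolding Suc sum.lessThan_Suc_shift by (simp add: pderiv_exp_entry_0)
qed (simp add: row_exp_def)

lemma pderiv_row_exp:
  "pderiv (row_exp N a u j) = row_exp N a (\<lambda>k. pderiv (u k) + row_A N a u k) j"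
proof -
  have "pderiv (row_exp N a u j) =
          row_exp N a (\<lambda>k. pderiv (u k)) j + (\<Sum>k<N. u k * pderiv (exp_entry a k j))"
    by (simp add: row_exp_def pderiv_sum pderiv_mult sum.distrib mult_ac add_ac)
  thus ?thesis by (simp add: row_exp_row_A[symmetric] row_exp_add)
qed

lemma of_nat_mult_row_exp:
  "of_nat j * row_exp N a u j = row_exp N a (\<lambda>k. of_nat k * u k - [:0, 1:] * row_A N a u k) j"
proof -
  have "of_nat j * row_exp N a u j = (\<Sum>k<N. u k * (of_nat j * exp_entry a k j))"
    by (simp only: row_exp_def sum_distrib_left mult_ac)
  also have "\<dots> = (\<Sum>k<N. (of_nat k * u k) * exp_entry a k j)
                   - [:0, 1:] * (\<Sum>k<N. u k * pderiv (exp_entry a k j))"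
    unfolding euler_exp_entry sum_distrib_left sum_subtractf[symmetric]
    by (simp only: right_diff_distrib mult_ac)
  also have "\<dots> = row_exp N a (\<lambda>k. of_nat k * u k) j - [:0, 1:] * row_exp N a (row_A N a u) j"
    unfolding row_exp_row_A by (simp only: row_exp_def)
  finally show ?thesis by (simp only: row_exp_mult row_exp_diff)
qed

text \<open>
  With indices counted from 1, the operator on entry \<open>j\<close> is \<open>x f'' + (\<nu> + j + 1 - x) f' - j f\<close>. The
  shift by \<open>- j\<close> compensates the degrees that \<open>e^{xA}\<close> adds to the entries of a row.
\<close>

definition diag_op :: "real \<Rightarrow> (nat \<Rightarrow> complex poly) \<Rightarrow> nat \<Rightarrow> complex poly" where
  "diag_op \<nu> q j = laguerre_op (\<nu> + real j + 1) (q j) - of_nat (j + 1) * q j"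

text \<open>
  The operator \<open>u \<mapsto> x u'' + u' (x A + \<nu> + 1 + J - x) + u (A (\<nu> + 1 + J) - J)\<close> on rows, which is
  \<open>diag_op\<close> conjugated by \<open>e^{xA}\<close>. The shifts by one come from counting indices from 0.
\<close>

definition row_op :: "nat \<Rightarrow> (nat \<Rightarrow> real) \<Rightarrow> real \<Rightarrow> (nat \<Rightarrow> complex poly) \<Rightarrow> nat \<Rightarrow> complex poly" where
  "row_op N a \<nu> u k =
     [:0, 1:] * pderiv (pderiv (u k)) + ([:of_real (\<nu> + 2), -1:] + of_nat k) * pderiv (u k)
     + [:0, 1:] * row_A N a (\<lambda>k. pderiv (u k)) k
     + ([:of_real (\<nu> + 2):] + of_nat k) * row_A N a u k - of_nat (k + 1) * u k"

text \<open>
  The coefficient of \<open>x^i\<close> depends on the coefficients of the row at \<open>i\<close> and \<open>i + 1\<close> only: the operator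
  does not raise the degree, and on the leading coefficient of a row of degree \<open>i\<close> it acts as the matrix
  \<open>\<Gamma>\<close> with index \<open>i\<close>.
\<close>

lemma coeff_row_op:
  "coeff (row_op N a \<nu> u k) i =
     of_nat (i + 1) * of_real (real i + \<nu> + real k + 2) * coeff (u k) (i + 1)
     - of_nat (i + k + 1) * coeff (u k) i
     + (if Suc k < N then of_real (a (Suc k) * (real i + \<nu> + real k + 2)) * coeff (u (Suc k)) i else 0)"
  by (cases i) (auto simp: row_op_def row_A_def of_nat_poly coeff_pderiv algebra_simps)

text \<open>
  Moving \<open>e^{xA}\<close> to the right turns \<open>d/dx\<close> into \<open>d/dx + A\<close> and \<open>J\<close> into \<open>J - x A\<close>. Two terms that
  would raise the degree cancel: \<open>x u A A\<close> from the second derivative against the \<open>J\<close> in the coefficient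
  of the first, and \<open>x u A\<close> from the first derivative against the shift by \<open>- J\<close> in \<open>diag_op\<close>.
\<close>

lemma diag_op_row_exp: "diag_op \<nu> (row_exp N a u) j = row_exp N a (row_op N a \<nu> u) j"
proof -
  define v where "v = (\<lambda>k. pderiv (u k) + row_A N a u k)"
  define w where "w = (\<lambda>k. pderiv (v k) + row_A N a v k)"
  define X :: "complex poly" where "X = [:0, 1:]"
  define C :: "complex poly" where "C = [:of_real (\<nu> + 2):]"
  let ?E = "\<lambda>u. row_exp N a u j"
  have CX: "[:of_real (\<nu> + 2), -1:] = C - X"
    by (simp add: C_def X_def)
  have pderiv1: "pderiv (row_exp N a u j) = ?E v" and pderiv2: "pderiv (row_exp N a v j) = ?E w"
    by (simp_all add: pderiv_row_exp v_def w_def)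
  have "[:of_real (\<nu> + real j + 1 + 1), -1:] = C - X + of_nat j"
    by (simp add: C_def X_def of_nat_poly)
  hence "diag_op \<nu> (row_exp N a u) j =
      X * ?E w + (C - X) * ?E v + of_nat j * ?E v - ?E u - of_nat j * ?E u"
    unfolding diag_op_def laguerre_op_def pderiv1 pderiv2 X_def[symmetric]
    by (simp only: of_nat_add of_nat_1 distrib_left distrib_right left_diff_distrib mult_1_left) simp
  also have "\<dots> = ?E (\<lambda>k. X * w k + (C - X) * v k + (of_nat k * v k - X * row_A N a v k)
                          - u k - (of_nat k * u k - X * row_A N a u k))"
    unfolding of_nat_mult_row_exp X_def[symmetric]
    by (simp only: row_exp_mult row_exp_add row_exp_diff)
  also have "(\<lambda>k. X * w k + (C - X) * v k + (of_nat k * v k - X * row_A N a v k)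
                   - u k - (of_nat k * u k - X * row_A N a u k)) = row_op N a \<nu> u"
  proof
    fix k
    have A_pderiv: "pderiv (row_A N a u k) = row_A N a (\<lambda>k. pderiv (u k)) k"
      by (simp add: row_A_def pderiv_smult)
    have wk: "w k = pderiv (pderiv (u k)) + row_A N a (\<lambda>k. pderiv (u k)) k + row_A N a v k"
      by (simp add: w_def v_def pderiv_add A_pderiv)
    have vk: "v k = pderiv (u k) + row_A N a u k" by (simp add: v_def)
    show "X * w k + (C - X) * v k + (of_nat k * v k - X * row_A N a v k)
            - u k - (of_nat k * u k - X * row_A N a u k) = row_op N a \<nu> u k"
      unfolding row_op_def CX C_def[symmetric] X_def[symmetric] wk vk
      by (simp add: algebra_simps)
  qed
  finally show ?thesis .
qed

section \<open>The inner product of rows\<close>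

text \<open>
  The inner product of rows for the diagonal weight \<open>T\<close>; for rows multiplied by \<open>e^{xA}\<close> it is the inner
  product given by \<open>W\<close>.
\<close>

definition row_inner ::
  "nat \<Rightarrow> real \<Rightarrow> (nat \<Rightarrow> real) \<Rightarrow> (nat \<Rightarrow> complex poly) \<Rightarrow> (nat \<Rightarrow> complex poly) \<Rightarrow> complex" where
  "row_inner N \<nu> \<delta> q r =
     (\<Sum>j<N. of_real (\<delta> (Suc j)) * weighted_integral (\<nu> + real j + 1) (q j * map_poly cnj (r j)))"

lemma map_poly_cnj_diff: "map_poly cnj (f - g) = map_poly cnj f - map_poly cnj g"
  by (intro poly_eqI) (simp add: coeff_map_poly)

lemma map_poly_cnj_smult: "map_poly cnj (smult c f) = smult (cnj c) (map_poly cnj f)"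
  by (intro poly_eqI) (simp add: coeff_map_poly)

lemma map_poly_cnj_sum: "map_poly cnj (\<Sum>l\<in>I. f l) = (\<Sum>l\<in>I. map_poly cnj (f l))"
  by (intro poly_eqI) (simp add: coeff_map_poly coeff_sum)

lemma map_poly_cnj_diag_op:
  "map_poly cnj (diag_op \<nu> q j) = diag_op \<nu> (\<lambda>j. map_poly cnj (q j)) j"
  by (intro poly_eqI) (simp add: diag_op_def coeff_map_poly coeff_laguerre_op of_nat_poly)

lemma row_inner_sum_left:
  assumes "\<nu> > -2"
  shows "row_inner N \<nu> \<delta> (\<lambda>j. \<Sum>l\<in>I. smult (c l) (q l j)) r
          = (\<Sum>l\<in>I. c l * row_inner N \<nu> \<delta> (q l) r)"
proof -
  have "\<nu> + real j + 1 > -1" for j using assms by simp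
  thus ?thesis
    unfolding row_inner_def sum_distrib_left sum_distrib_right
    by (simp add: weighted_integral_sum weighted_integral_smult sum_distrib_left mult_ac)
       (subst sum.swap, rule refl)
qed

lemma row_inner_add_smult_left:
  assumes "\<nu> > -2"
  shows "row_inner N \<nu> \<delta> (\<lambda>j. q j + smult c (s j)) r = row_inner N \<nu> \<delta> q r + c * row_inner N \<nu> \<delta> s r"
proof -
  have "\<nu> + real j + 1 > -1" for j using assms by simp
  thus ?thesis
    unfolding row_inner_def
    by (simp add: distrib_right weighted_integral_add weighted_integral_smult sum.distrib
          sum_distrib_left algebra_simps)
qed

lemma row_inner_diff_right:
  assumes "\<nu> > -2"
  shows "row_inner N \<nu> \<delta> q (\<lambda>j. r j - s j) = row_inner N \<nu> \<delta> q r - row_inner N \<nu> \<delta> q s"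
proof -
  have "\<nu> + real j + 1 > -1" for j using assms by simp
  thus ?thesis
    unfolding row_inner_def
    by (simp add: map_poly_cnj_diff right_diff_distrib weighted_integral_diff sum_subtractf)
qed

lemma row_inner_sum_right:
  assumes "\<nu> > -2"
  shows "row_inner N \<nu> \<delta> q (\<lambda>j. \<Sum>l\<in>I. smult (c l) (r l j))
          = (\<Sum>l\<in>I. cnj (c l) * row_inner N \<nu> \<delta> q (r l))"
proof -
  have "\<nu> + real j + 1 > -1" for j using assms by simp
  thus ?thesis
    unfolding row_inner_def map_poly_cnj_sum map_poly_cnj_smult sum_distrib_left
    by (simp add: weighted_integral_sum weighted_integral_smult sum_distrib_left mult_ac)
       (subst sum.swap, rule refl)
qed

lemma diag_op_symmetric:
  assumes "\<nu> > -2"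
  shows "row_inner N \<nu> \<delta> (diag_op \<nu> q) r = row_inner N \<nu> \<delta> q (diag_op \<nu> r)"
  unfolding row_inner_def
proof (intro sum.cong refl arg_cong2[of _ _ _ _ "(*)"])
  fix j
  have \<alpha>: "\<nu> + real j + 1 > -1" using assms by simp
  have comm: "of_nat (j + 1) * q j * g = q j * (of_nat (j + 1) * g)" for g
    by (simp only: mult_ac)
  show "weighted_integral (\<nu> + real j + 1) (diag_op \<nu> q j * map_poly cnj (r j)) =
        weighted_integral (\<nu> + real j + 1) (q j * map_poly cnj (diag_op \<nu> r j))"
    unfolding map_poly_cnj_diag_op
    by (simp only: diag_op_def left_diff_distrib right_diff_distrib weighted_integral_diff[OF \<alpha>]
        laguerre_op_symmetric[OF \<alpha>] comm)
qed

lemma row_inner_definite: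
  assumes "\<nu> > -2" and \<delta>: "\<And>j. j < N \<Longrightarrow> \<delta> (Suc j) > 0"
    and zero: "row_inner N \<nu> \<delta> q q = 0" and "j < N"
  shows "q j = 0"
proof -
  have \<alpha>: "\<nu> + real j + 1 > -1" for j using assms(1) by simp
  define I where "I j = (LINT x:{0..}|lborel. (cmod (poly (q j) (of_real x)))\<^sup>2 *
                           (exp (- x) * x powr (\<nu> + real j + 1)))" for j
  have I: "weighted_integral (\<nu> + real j + 1) (q j * map_poly cnj (q j)) = of_real (I j)" for j
    unfolding I_def by (rule weighted_integral_norm_square[OF \<alpha>])
  have nonneg: "I j \<ge> 0" for j
    unfolding I_def set_lebesgue_integral_def by (intro integral_nonneg_AE) auto
  have "complex_of_real (\<Sum>j<N. \<delta> (Suc j) * I j) = 0"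
    using zero by (simp add: row_inner_def I)
  hence "(\<Sum>j<N. \<delta> (Suc j) * I j) = 0" by (simp only: of_real_eq_0_iff)
  hence "\<delta> (Suc j) * I j = 0"
    by (subst (asm) sum_nonneg_eq_0_iff) (use \<delta> nonneg \<open>j < N\<close> in \<open>auto intro: mult_nonneg_nonneg less_imp_le\<close>)
  hence "I j = 0" using \<delta>[OF \<open>j < N\<close>] by simp
  thus ?thesis
    using weighted_integral_norm_square_eq_0[OF \<alpha>, of j "q j"] I by simp
qed

section \<open>The matrix weight in terms of rows\<close>

lemma A_mat_carrier: "A_mat N a \<in> carrier_mat N N"
  by (simp add: A_mat_def)

lemma index_mult_square_mat:
  assumes "X \<in> carrier_mat N N" "Y \<in> carrier_mat N N" "i < N" "j < N"
  shows "(X * Y) $$ (i, j) = (\<Sum>l<N. X $$ (i, l) * Y $$ (l, j))"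
  using assms by (auto simp: scalar_prod_def atLeast0LessThan)

lemma mat_adjoint_carrier: "M \<in> carrier_mat N N \<Longrightarrow> mat_adjoint M \<in> carrier_mat N N"
  unfolding mat_adjoint_def by auto

lemma mat_adjoint_index:
  assumes "M \<in> carrier_mat N N" "i < N" "j < N"
  shows "mat_adjoint M $$ (i, j) = conjugate (M $$ (j, i))"
  using assms by (simp add: mat_adjoint_def mat_of_rows_index)

lemma pow_A_mat_index:
  assumes "i < N" "j < N"
  shows "((x \<cdot>\<^sub>m A_mat N a) ^\<^sub>m m) $$ (i, j) =
           (if i = j + m then of_real (\<Prod>l\<in>{j<..i}. a l) * x ^ m else 0)"
  using assms
proof (induction m arbitrary: j)
  case 0
  thus ?case by (simp add: A_mat_def)
next
  case (Suc m)
  let ?M = "x \<cdot>\<^sub>m A_mat N a"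
  have M: "?M \<in> carrier_mat N N" by (simp add: A_mat_def)
  have "(?M ^\<^sub>m Suc m) $$ (i, j) = (\<Sum>l<N. (?M ^\<^sub>m m) $$ (i, l) * ?M $$ (l, j))"
    unfolding pow_mat.simps
    by (rule index_mult_square_mat[OF pow_carrier_mat[OF M] M Suc.prems])
  also have "\<dots> = (\<Sum>l<N. if l = Suc j then (?M ^\<^sub>m m) $$ (i, Suc j) * (x * of_real (a (Suc j))) else 0)"
    using Suc.prems by (intro sum.cong) (auto simp: A_mat_def)
  also have "\<dots> = (if Suc j < N then (?M ^\<^sub>m m) $$ (i, Suc j) * (x * of_real (a (Suc j))) else 0)"
    by simp
  also have "\<dots> = (if i = j + Suc m then of_real (\<Prod>l\<in>{j<..i}. a l) * x ^ Suc m else 0)"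
  proof (cases "i = j + Suc m")
    case True
    hence "{j<..i} = insert (Suc j) {Suc j<..i}" by auto
    hence "(\<Prod>l\<in>{j<..i}. a l) = a (Suc j) * (\<Prod>l\<in>{Suc j<..i}. a l)" by simp
    thus ?thesis using True Suc.IH[of "Suc j"] Suc.prems by (simp add: mult_ac)
  qed (use Suc in auto)
  finally show ?case .
qed

lemma pow_adjoint_A_mat_index:
  assumes "i < N" "j < N"
  shows "((x \<cdot>\<^sub>m mat_adjoint (A_mat N a)) ^\<^sub>m m) $$ (i, j) =
           (if j = i + m then of_real (\<Prod>l\<in>{i<..j}. a l) * x ^ m else 0)"
  using assms
proof (induction m arbitrary: j)
  case 0
  thus ?case using mat_adjoint_carrier[OF A_mat_carrier[of N a]] by auto
next
  case (Suc m)
  let ?M = "x \<cdot>\<^sub>m mat_adjoint (A_mat N a)"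
  note A' = mat_adjoint_carrier[OF A_mat_carrier[of N a]]
  have M: "?M \<in> carrier_mat N N" using A' by simp
  have entry: "?M $$ (l, j) = (if j = Suc l then x * of_real (a j) else 0)" if "l < N" for l
  proof -
    have "?M $$ (l, j) = x * cnj (A_mat N a $$ (j, l))"
      using that Suc.prems A' by (simp add: mat_adjoint_index[OF A_mat_carrier])
    thus ?thesis using that Suc.prems by (simp add: A_mat_def)
  qed
  have "(?M ^\<^sub>m Suc m) $$ (i, j) = (\<Sum>l<N. (?M ^\<^sub>m m) $$ (i, l) * ?M $$ (l, j))"
    unfolding pow_mat.simps
    by (rule index_mult_square_mat[OF pow_carrier_mat[OF M] M Suc.prems])
  also have "\<dots> = (\<Sum>l<N. if j = Suc l then (?M ^\<^sub>m m) $$ (i, l) * (x * of_real (a j)) else 0)"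
    by (intro sum.cong) (auto simp del: index_smult_mat simp: entry)
  also have "\<dots> = (if j = i + Suc m then of_real (\<Prod>l\<in>{i<..j}. a l) * x ^ Suc m else 0)"
  proof (cases j)
    case (Suc j')
    have "(\<Sum>l<N. if j = Suc l then (?M ^\<^sub>m m) $$ (i, l) * (x * of_real (a j)) else 0)
            = (?M ^\<^sub>m m) $$ (i, j') * (x * of_real (a j))"
      using Suc.prems Suc by (simp add: sum.delta)
    moreover have "{i<..j} = insert j {i<..j'}" if "j' = i + m" using that Suc by auto
    ultimately show ?thesis using Suc.IH[of j'] Suc.prems Suc by (simp add: mult_ac)
  qed auto
  finally show ?case .
qed

lemma exp_entry_sums:
  "(\<Sum>k. (if i = j + k then of_real (\<Prod>l\<in>{j<..i}. a l) * x ^ k else 0) / fact k)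
     = poly (exp_entry a i j) x"
  by (subst suminf_finite[where N = "{i - j}"]) (auto simp: exp_entry_def poly_monom)

lemma mat_exp_A_mat:
  "mat_exp (x \<cdot>\<^sub>m A_mat N a) = mat N N (\<lambda>(i, j). poly (exp_entry a i j) x)"
  unfolding mat_exp_def
  by (rule eq_matI) (simp_all add: pow_A_mat_index exp_entry_sums A_mat_def[of N a, THEN arg_cong[of _ _ dim_row]])

lemma mat_exp_adjoint_A_mat:
  "mat_exp (x \<cdot>\<^sub>m mat_adjoint (A_mat N a)) = mat N N (\<lambda>(i, j). poly (exp_entry a j i) x)"
  using mat_adjoint_carrier[OF A_mat_carrier[of N a]] unfolding mat_exp_def
  by (intro eq_matI) (auto simp add: pow_adjoint_A_mat_index exp_entry_sums)

abbreviation poly_row :: "complex poly mat \<Rightarrow> nat \<Rightarrow> nat \<Rightarrow> complex poly" where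
  "poly_row P i \<equiv> \<lambda>k. P $$ (i, k)"

lemma cnj_exp_entry: "cnj (poly (exp_entry a i j) (of_real x)) = poly (exp_entry a i j) (of_real x)"
  by (simp add: exp_entry_def poly_monom)

lemma eval_mat_carrier: "P \<in> carrier_mat N N \<Longrightarrow> eval_mat P x \<in> carrier_mat N N"
  by (simp add: eval_mat_def)

lemma eval_mat_mult_exp_index:
  assumes "P \<in> carrier_mat N N" "i < N" "j < N"
  shows "(eval_mat P x * mat_exp (of_real x \<cdot>\<^sub>m A_mat N a)) $$ (i, j)
           = poly (row_exp N a (poly_row P i) j) (of_real x)"
  using assms
  by (simp add: mat_exp_A_mat eval_mat_def scalar_prod_def row_exp_def poly_sum atLeast0LessThan)

lemma exp_mult_adjoint_eval_mat_index:
  assumes "Q \<in> carrier_mat N N" "i < N" "j < N"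
  shows "(mat_exp (of_real x \<cdot>\<^sub>m mat_adjoint (A_mat N a)) * mat_adjoint (eval_mat Q x)) $$ (i, j)
           = poly (map_poly cnj (row_exp N a (poly_row Q j) i)) (of_real x)"
proof -
  note Q' = mat_adjoint_carrier[OF eval_mat_carrier[OF assms(1), of x]]
  have "(mat_exp (of_real x \<cdot>\<^sub>m mat_adjoint (A_mat N a)) * mat_adjoint (eval_mat Q x)) $$ (i, j)
          = (\<Sum>k<N. poly (exp_entry a k i) (of_real x) * mat_adjoint (eval_mat Q x) $$ (k, j))"
    using assms Q' by (simp add: mat_exp_adjoint_A_mat scalar_prod_def atLeast0LessThan)
  also have "\<dots> = (\<Sum>k<N. poly (exp_entry a k i) (of_real x) * cnj (poly (Q $$ (j, k)) (of_real x)))"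
    using assms
    by (intro sum.cong refl)
       (simp add: mat_adjoint_index[OF eval_mat_carrier[OF assms(1)]], simp add: eval_mat_def)
  also have "\<dots> = poly (map_poly cnj (row_exp N a (poly_row Q j) i)) (of_real x)"
    by (simp add: row_exp_def poly_sum cnj_exp_entry mult_ac)
  finally show ?thesis .
qed

text \<open>
  The weight factors as \<open>e^{xA} T (e^{xA})\<^sup>*\<close>, so the two exponentials are absorbed into the rows of \<open>P\<close>
  and \<open>Q\<close>, and what is left is the diagonal weight.
\<close>

lemma W_inner_index:
  assumes P: "P \<in> carrier_mat N N" and Q: "Q \<in> carrier_mat N N" and ij: "i < N" "j < N"
    and "\<nu> > -2"
  shows "W_inner N a \<nu> \<delta> P Q $$ (i, j) =
           row_inner N \<nu> \<delta> (row_exp N a (poly_row P i)) (row_exp N a (poly_row Q j))"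
proof -
  let ?p = "row_exp N a (poly_row P i)" and ?q = "row_exp N a (poly_row Q j)"
  have \<alpha>: "\<nu> + real k + 1 > -1" for k using assms by simp
  define G where "G x = eval_mat P x * mat_exp (of_real x \<cdot>\<^sub>m A_mat N a)" for x
  define H where "H x = mat_exp (of_real x \<cdot>\<^sub>m mat_adjoint (A_mat N a)) * mat_adjoint (eval_mat Q x)" for x
  have C: "eval_mat P x \<in> carrier_mat N N" "mat_adjoint (eval_mat Q x) \<in> carrier_mat N N"
     "mat_exp (of_real x \<cdot>\<^sub>m A_mat N a) \<in> carrier_mat N N" "T_weight N \<nu> \<delta> x \<in> carrier_mat N N"
     "mat_exp (of_real x \<cdot>\<^sub>m mat_adjoint (A_mat N a)) \<in> carrier_mat N N" for x
    using eval_mat_carrier[OF P] mat_adjoint_carrier[OF eval_mat_carrier[OF Q]]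
    by (simp_all add: mat_exp_A_mat mat_exp_adjoint_A_mat T_weight_def)
  have GH: "G x \<in> carrier_mat N N" "H x \<in> carrier_mat N N" for x
    unfolding G_def H_def using C by (blast intro: mult_carrier_mat)+
  have integrand: "(eval_mat P x * W_weight N a \<nu> \<delta> x * mat_adjoint (eval_mat Q x)) $$ (i, j) =
     (\<Sum>k<N. of_real (\<delta> (Suc k)) * (poly (?p k * map_poly cnj (?q k)) (of_real x) *
         of_real (exp (- x) * x powr (\<nu> + real k + 1))))" for x
  proof -
    have "eval_mat P x * W_weight N a \<nu> \<delta> x * mat_adjoint (eval_mat Q x)
            = G x * T_weight N \<nu> \<delta> x * H x"
      unfolding W_weight_def G_def H_def
      using C[of x] by (simp add: assoc_mult_mat[where ?n\<^sub>1 = N and ?n\<^sub>2 = N and ?n\<^sub>3 = N and ?n\<^sub>4 = N] mult_carrier_mat[where n = N])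
    also have "\<dots> $$ (i, j) = (\<Sum>k<N. G x $$ (i, k) *
         of_real (exp (- x) * (\<delta> (Suc k) * x powr (\<nu> + real (Suc k)))) * H x $$ (k, j))"
      using GH[of x] ij unfolding T_weight_def mat_diag_mult_right[OF GH(1)]
      by (simp add: scalar_prod_def atLeast0LessThan)
    also have "\<dots> = (\<Sum>k<N. of_real (\<delta> (Suc k)) * (poly (?p k * map_poly cnj (?q k)) (of_real x) *
         of_real (exp (- x) * x powr (\<nu> + real k + 1))))"
    proof (intro sum.cong refl)
      fix k assume "k \<in> {..<N}"
      hence "k < N" by simp
      \<comment> \<open>only the form of the exponent differs, by the two ways to count indices\<close>
      have "\<nu> + real (Suc k) = \<nu> + real k + 1" by simp
      thus "G x $$ (i, k) * of_real (exp (- x) * (\<delta> (Suc k) * x powr (\<nu> + real (Suc k)))) * H x $$ (k, j)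
        = of_real (\<delta> (Suc k)) * (poly (?p k * map_poly cnj (?q k)) (of_real x) *
         of_real (exp (- x) * x powr (\<nu> + real k + 1)))"
        unfolding G_def H_def eval_mat_mult_exp_index[OF P ij(1) \<open>k < N\<close>]
          exp_mult_adjoint_eval_mat_index[OF Q \<open>k < N\<close> ij(2)]
        by (simp only: poly_mult of_real_mult mult_ac)
    qed
    finally show ?thesis .
  qed
  have "W_inner N a \<nu> \<delta> P Q $$ (i, j) =
     (LINT x:{0..}|lborel. \<Sum>k<N. of_real (\<delta> (Suc k)) * (poly (?p k * map_poly cnj (?q k)) (of_real x) *
         of_real (exp (- x) * x powr (\<nu> + real k + 1))))"
    using ij by (simp only: W_inner_def index_mat integrand prod.case)
  also have "\<dots> = (\<Sum>k<N. LINT x:{0..}|lborel. of_real (\<delta> (Suc k)) * (poly (?p k * map_poly cnj (?q k)) (of_real x) *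
         of_real (exp (- x) * x powr (\<nu> + real k + 1))))"
    unfolding set_lebesgue_integral_def scaleR_sum_right
    by (intro Bochner_Integration.integral_sum,
        rule set_integrable_mult_right[OF weighted_poly_integrable[OF \<alpha>], unfolded set_integrable_def])
  also have "\<dots> = row_inner N \<nu> \<delta> ?p ?q"
    unfolding row_inner_def weighted_integral_def by simp
  finally show ?thesis .
qed

section \<open>Orthogonality forces eigenfunctions\<close>

text \<open>
  Phrased through coefficients, so that for \<open>n = 0\<close> only the zero row qualifies.
\<close>

definition row_degree_less :: "nat \<Rightarrow> nat \<Rightarrow> (nat \<Rightarrow> complex poly) \<Rightarrow> bool" where
  "row_degree_less N n u \<longleftrightarrow> (\<forall>k<N. \<forall>i\<ge>n. coeff (u k) i = 0)"

lemma row_degree_less_row_op: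
  assumes "row_degree_less N n u"
  shows "row_degree_less N n (row_op N a \<nu> u)"
  using assms by (simp add: row_degree_less_def coeff_row_op)

text \<open>
  Let \<open>u\<close> have degree at most \<open>n\<close> and be orthogonal to all rows of lower degree, and let its leading
  coefficient be an eigenvector with eigenvalue \<open>- c\<close>. Then \<open>E = (row_op + c) u\<close> has degree below \<open>n\<close>. As
  \<open>diag_op\<close> is symmetric and \<open>row_op\<close> does not raise the degree, \<open>E\<close> is again orthogonal to all rows
  of lower degree, hence to itself, and \<open>row_exp N a E\<close> vanishes.
\<close>

lemma diag_op_eigenfunction:
  assumes \<nu>: "\<nu> > -2" and \<delta>: "\<And>j. j < N \<Longrightarrow> \<delta> (Suc j) > 0"
    and degree: "row_degree_less N (Suc n) u"
    and orthogonal: "\<And>v. row_degree_less N n v \<Longrightarrow>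
           row_inner N \<nu> \<delta> (row_exp N a u) (row_exp N a v) = 0"
    and lead: "\<And>k. k < N \<Longrightarrow> coeff (row_op N a \<nu> u k) n + c * coeff (u k) n = 0"
    and "j < N"
  shows "diag_op \<nu> (row_exp N a u) j + smult c (row_exp N a u j) = 0"
proof -
  define E where "E = (\<lambda>k. row_op N a \<nu> u k + smult c (u k))"
  have E: "row_exp N a E = (\<lambda>j. diag_op \<nu> (row_exp N a u) j + smult c (row_exp N a u j))"
    by (simp add: E_def diag_op_row_exp row_exp_smult row_exp_add)
  have "row_degree_less N n E"
    unfolding row_degree_less_def
  proof (intro allI impI)
    fix k i assume "k < N" "n \<le> i"
    show "coeff (E k) i = 0"
    proof (cases "i = n")
      case True
      thus ?thesis using lead[OF \<open>k < N\<close>] by (simp add: E_def)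
    next
      case False
      thus ?thesis
        using degree row_degree_less_row_op[OF degree] \<open>k < N\<close> \<open>n \<le> i\<close>
        by (simp add: E_def row_degree_less_def)
    qed
  qed
  hence "row_inner N \<nu> \<delta> (row_exp N a u) (row_exp N a E) = 0"
    and "row_inner N \<nu> \<delta> (row_exp N a u) (row_exp N a (row_op N a \<nu> E)) = 0"
    by (auto intro: orthogonal row_degree_less_row_op)
  moreover have "row_exp N a (row_op N a \<nu> E) = diag_op \<nu> (row_exp N a E)"
    by (simp add: fun_eq_iff diag_op_row_exp)
  ultimately have "row_inner N \<nu> \<delta> (row_exp N a E) (row_exp N a E) = 0"
    by (subst (1) E) (simp add: row_inner_add_smult_left[OF \<nu>] diag_op_symmetric[OF \<nu>])
  hence "row_exp N a E j = 0"
    using \<delta> \<open>j < N\<close> by (intro row_inner_definite[OF \<nu>, of N \<delta> "row_exp N a E"]) auto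
  thus ?thesis by (simp add: E)
qed

lemma monic_of_degree_coeff:
  assumes "monic_of_degree N n P" "l < N" "k < N"
  shows "coeff (P $$ (l, k)) n = (if l = k then 1 else 0)"
proof -
  have P: "P \<in> carrier_mat N N" using assms(1) by (simp add: monic_of_degree_def)
  have "coeff (P $$ (l, k)) n = map_mat (\<lambda>p. coeff p n) P $$ (l, k)"
    using assms(2,3) P by simp
  also have "\<dots> = 1\<^sub>m N $$ (l, k)"
    using assms by (simp add: monic_of_degree_def)
  finally show ?thesis using assms by simp
qed

text \<open>
  As \<open>P m\<close> is monic, subtracting a combination of its rows removes the coefficient of \<open>x^m\<close> from a
  row of degree \<open>m\<close>. By induction, rows of degree below \<open>n\<close> are combinations of rows of
  \<open>P 0, \<dots>, P (n - 1)\<close>.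
\<close>

lemma orthogonal_to_lower_degree:
  assumes \<nu>: "\<nu> > -2" and P: "monic_orthogonal N a \<nu> \<delta> P" and "l < N"
    and "m \<le> n" "row_degree_less N m u"
  shows "row_inner N \<nu> \<delta> (row_exp N a (poly_row (P n) l)) (row_exp N a u) = 0"
  using assms(4,5)
proof (induction m arbitrary: u)
  case 0
  hence "u k = 0" if "k < N" for k
    using that by (intro poly_eqI) (simp add: row_degree_less_def)
  hence "row_exp N a u = (\<lambda>j. 0)" by (simp add: row_exp_def fun_eq_iff)
  thus ?case by (simp add: row_inner_def weighted_integral_def)
next
  case (Suc m)
  define c where "c l = coeff (u l) m" for l
  define v where "v k = u k - (\<Sum>l<N. smult (c l) (P m $$ (l, k)))" for k
  have monic: "monic_of_degree N m (P m)" and carrier: "P k \<in> carrier_mat N N" for k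
    using P by (auto simp: monic_orthogonal_def monic_of_degree_def)
  have "row_degree_less N m v"
    unfolding row_degree_less_def
  proof (intro allI impI)
    fix k i assume "k < N" "m \<le> i"
    show "coeff (v k) i = 0"
    proof (cases "i = m")
      case True
      have "(\<Sum>l<N. c l * coeff (P m $$ (l, k)) m) = (\<Sum>l<N. if l = k then c k else 0)"
        using monic_of_degree_coeff[OF monic] \<open>k < N\<close> by (intro sum.cong) auto
      thus ?thesis using True \<open>k < N\<close> by (simp add: v_def coeff_sum c_def)
    next
      case False
      hence "m < i" using \<open>m \<le> i\<close> by simp
      moreover have "coeff (P m $$ (l, k)) i = 0" if "l < N" for l
        using monic that \<open>k < N\<close> \<open>m < i\<close> unfolding monic_of_degree_def
        by (meson coeff_eq_0 le_less_trans)
      ultimately show ?thesis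
        using Suc.prems(2) \<open>k < N\<close> by (simp add: v_def coeff_sum row_degree_less_def)
    qed
  qed
  hence v: "row_inner N \<nu> \<delta> (row_exp N a (poly_row (P n) l)) (row_exp N a v) = 0"
    using Suc.IH Suc.prems(1) by simp
  have "row_exp N a v = (\<lambda>j. row_exp N a u j - (\<Sum>l<N. smult (c l) (row_exp N a (poly_row (P m) l) j)))"
    unfolding v_def row_exp_smult row_exp_sum row_exp_diff ..
  hence "row_inner N \<nu> \<delta> (row_exp N a (poly_row (P n) l)) (row_exp N a u) =
      (\<Sum>l'<N. cnj (c l') * row_inner N \<nu> \<delta> (row_exp N a (poly_row (P n) l))
                                          (row_exp N a (poly_row (P m) l')))"
    using v by (simp add: row_inner_diff_right[OF \<nu>] row_inner_sum_right[OF \<nu>])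
  also have "\<dots> = (\<Sum>l'<N. cnj (c l') * W_inner N a \<nu> \<delta> (P n) (P m) $$ (l, l'))"
    using \<open>l < N\<close> by (intro sum.cong) (auto simp: W_inner_index[OF carrier carrier _ _ \<nu>])
  also have "W_inner N a \<nu> \<delta> (P n) (P m) = 0\<^sub>m N N"
    using P Suc.prems(1) by (simp add: monic_orthogonal_def)
  finally show ?case using \<open>l < N\<close> by simp
qed

section \<open>The eigenvectors of the leading coefficient matrix\<close>

lemma mat_inv_unit_lower_triangular:
  assumes "unit_lower_triangular N K"
  shows "mat_inv K \<in> carrier_mat N N" "mat_inv K * K = 1\<^sub>m N"
proof -
  have K: "K \<in> carrier_mat N N" using assms by (simp add: unit_lower_triangular_def)
  have "det K = prod_list (diag_mat K)"
    by (rule det_lower_triangular[OF _ K]) (use assms in \<open>auto simp: unit_lower_triangular_def\<close>)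
  also have "\<dots> = 1"
    using assms K unfolding prod_list_diag_prod by (intro prod.neutral) (auto simp: unit_lower_triangular_def)
  finally have "K \<in> Units (ring_mat TYPE(complex) N ())"
    by (intro det_non_zero_imp_unit[OF K]) simp
  then obtain L where L: "mat_inverse K = Some L"
    using mat_inverse(1)[OF K, of "()"] by (cases "mat_inverse K") auto
  from mat_inverse(2)[OF K this] L
  show "mat_inv K \<in> carrier_mat N N" "mat_inv K * K = 1\<^sub>m N" by (auto simp: mat_inv_def)
qed

lemma Gamma_mat_index:
  assumes "l < N" "k < N"
  shows "Gamma_mat N a \<nu> n $$ (l, k) =
           (if l = Suc k then of_real (a l * (real n + \<nu> + real k + 2)) else 0)
           - (if l = k then of_nat (n + k + 1) else 0)"
proof -
  let ?S = "scalar_mat N (of_real (real n + \<nu> + 1)) + J_mat N"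
  have S: "?S \<in> carrier_mat N N" by (simp add: scalar_mat_def J_mat_def)
  have "(A_mat N a * ?S) $$ (l, k) = (\<Sum>i<N. A_mat N a $$ (l, i) * ?S $$ (i, k))"
    by (rule index_mult_square_mat[OF A_mat_carrier S assms])
  also have "\<dots> = (\<Sum>i<N. if i = k then A_mat N a $$ (l, k) * of_real (real n + \<nu> + real k + 2) else 0)"
    using assms by (intro sum.cong) (auto simp: scalar_mat_def J_mat_def mat_diag_def)
  also have "\<dots> = (if l = Suc k then of_real (a l * (real n + \<nu> + real k + 2)) else 0)"
    using assms by (simp add: A_mat_def)
  finally have "(A_mat N a * ?S) $$ (l, k) = \<dots>" .
  moreover have "(scalar_mat N (of_nat n) + J_mat N) $$ (l, k) = (if l = k then of_nat (n + k + 1) else 0)"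
    using assms by (simp add: scalar_mat_def J_mat_def mat_diag_def)
  moreover have "scalar_mat N (of_nat n) + J_mat N \<in> carrier_mat N N"
    by (simp add: scalar_mat_def J_mat_def)
  ultimately show ?thesis
    using assms unfolding Gamma_mat_def by (subst index_minus_mat) auto
qed

text \<open>
  The rows of \<open>K\<^sup>-\<^sup>1\<close> are left eigenvectors of \<open>\<Gamma>\<close>: this is entry \<open>(i, k)\<close> of
  \<open>K\<^sup>-\<^sup>1 \<Gamma> = \<Lambda> K\<^sup>-\<^sup>1\<close>.
\<close>

lemma mat_inv_Gamma_row:
  assumes K: "diagonalizes_Gamma N a \<nu> n K" and ik: "i < N" "k < N"
  shows "(if Suc k < N then of_real (a (Suc k) * (real n + \<nu> + real k + 2)) * mat_inv K $$ (i, Suc k) else 0)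
           - of_nat (n + k + 1) * mat_inv K $$ (i, k) + of_nat (n + i + 1) * mat_inv K $$ (i, k) = 0"
proof -
  let ?L = "mat_inv K" and ?\<Gamma> = "Gamma_mat N a \<nu> n" and ?\<Lambda> = "Lambda_mat N n"
  have tri: "unit_lower_triangular N K" and \<Gamma>: "?\<Gamma> = K * ?\<Lambda> * ?L"
    using K by (auto simp: diagonalizes_Gamma_def)
  note L = mat_inv_unit_lower_triangular[OF tri]
  have C: "K \<in> carrier_mat N N" "?\<Lambda> \<in> carrier_mat N N"
    using tri by (simp_all add: unit_lower_triangular_def Lambda_mat_def scalar_mat_def J_mat_def)
  hence \<Gamma>C: "?\<Gamma> \<in> carrier_mat N N" using L(1) unfolding \<Gamma> by (blast intro: mult_carrier_mat)
  have "?L * ?\<Gamma> = ?L * (K * (?\<Lambda> * ?L))"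
    unfolding \<Gamma> using assoc_mult_mat[OF C L(1)] by simp
  also have "\<dots> = ?L * K * (?\<Lambda> * ?L)"
    by (rule assoc_mult_mat[symmetric]) (use L(1) C in \<open>blast intro: mult_carrier_mat\<close>)+
  also have "\<dots> = ?\<Lambda> * ?L"
    unfolding L(2) by (rule left_mult_one_mat) (use L(1) C in \<open>blast intro: mult_carrier_mat\<close>)
  finally have eq: "(?L * ?\<Gamma>) $$ (i, k) = (?\<Lambda> * ?L) $$ (i, k)" by simp
  have "(?L * ?\<Gamma>) $$ (i, k) = (\<Sum>l<N. ?L $$ (i, l) * ?\<Gamma> $$ (l, k))"
    by (rule index_mult_square_mat[OF L(1) \<Gamma>C ik])
  also have "\<dots> = (\<Sum>l<N. (if l = Suc k then of_real (a (Suc k) * (real n + \<nu> + real k + 2)) * ?L $$ (i, Suc k) else 0)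
                    - (if l = k then of_nat (n + k + 1) * ?L $$ (i, k) else 0))"
    using ik by (intro sum.cong) (auto simp: Gamma_mat_index algebra_simps)
  also have "\<dots> = (if Suc k < N then of_real (a (Suc k) * (real n + \<nu> + real k + 2)) * ?L $$ (i, Suc k) else 0)
                    - of_nat (n + k + 1) * ?L $$ (i, k)"
    using ik by (simp add: sum_subtractf)
  finally have lhs: "(?L * ?\<Gamma>) $$ (i, k) = \<dots>" .
  have "(?\<Lambda> * ?L) $$ (i, k) = (\<Sum>l<N. ?\<Lambda> $$ (i, l) * ?L $$ (l, k))"
    by (rule index_mult_square_mat[OF C(2) L(1) ik])
  also have "\<dots> = (\<Sum>l<N. if l = i then - of_nat (n + i + 1) * ?L $$ (i, k) else 0)"
    using ik by (intro sum.cong) (auto simp: Lambda_mat_def scalar_mat_def J_mat_def mat_diag_def)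
  also have "\<dots> = - of_nat (n + i + 1) * ?L $$ (i, k)" using ik by simp
  finally have rhs: "(?\<Lambda> * ?L) $$ (i, k) = \<dots>" .
  have "x + d * y = 0" if "x = - d * y" for x d y :: complex using that by simp
  from this[OF eq[unfolded lhs rhs]] show ?thesis .
qed

text \<open>
  Row \<open>i\<close> of \<open>R\<close> arises from row \<open>i\<close> of \<open>K\<^sup>-\<^sup>1 P\<close>, which is a row of polynomials, by multiplication
  with \<open>e^{xA}\<close>.
\<close>

lemma R_mat_index:
  assumes P: "P \<in> carrier_mat N N" and K: "mat_inv K \<in> carrier_mat N N" and ij: "i < N" "j < N"
  shows "R_mat N a K P x $$ (i, j) =
           poly (row_exp N a (\<lambda>k. \<Sum>l<N. smult (mat_inv K $$ (i, l)) (P $$ (l, k))) j) (of_real x)"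
proof -
  note C = K eval_mat_carrier[OF P, of x]
  have E: "mat_exp (of_real x \<cdot>\<^sub>m A_mat N a) \<in> carrier_mat N N" by (simp add: mat_exp_A_mat)
  have "R_mat N a K P x $$ (i, j) =
          (\<Sum>l<N. mat_inv K $$ (i, l) * (eval_mat P x * mat_exp (of_real x \<cdot>\<^sub>m A_mat N a)) $$ (l, j))"
    unfolding R_mat_def assoc_mult_mat[OF C E]
    by (rule index_mult_square_mat[OF K mult_carrier_mat[OF C(2) E] ij])
  also have "\<dots> = (\<Sum>l<N. poly (smult (mat_inv K $$ (i, l)) (row_exp N a (poly_row P l) j)) (of_real x))"
    using ij by (intro sum.cong) (simp_all add: eval_mat_mult_exp_index[OF P])
  also have "\<dots> = poly (\<Sum>l<N. smult (mat_inv K $$ (i, l)) (row_exp N a (poly_row P l) j)) (of_real x)"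
    by (simp add: poly_sum)
  finally show ?thesis unfolding row_exp_smult row_exp_sum .
qed

section \<open>The entries of \<open>R\<close>\<close>

theorem theorem6p4:
  fixes N :: nat and a :: "nat \<Rightarrow> real" and \<nu> :: real and \<delta> :: "nat \<Rightarrow> real"
    and P :: "nat \<Rightarrow> complex poly mat" and K :: "nat \<Rightarrow> complex mat"
  assumes "N \<ge> 1"
    and "\<nu> > 0"
    and "\<And>k. k \<in> {1..N} \<Longrightarrow> \<delta> k > 0"
    and "monic_orthogonal N a \<nu> \<delta> P"
    and "\<And>n. diagonalizes_Gamma N a \<nu> n (K n)"
  shows "\<exists>\<xi> :: nat \<Rightarrow> nat \<Rightarrow> nat \<Rightarrow> complex.
    \<forall>n. \<forall>i\<in>{1..N}. \<forall>j\<in>{1..N}. \<forall>x::real.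
      R_mat N a (K n) (P n) x $$ (i - 1, j - 1) =
        (if j \<le> n + i
         then of_real (poly (laguerre (n + i - j) (\<nu> + real j)) x) * \<xi> n i j
         else 0)"
proof -
  have \<nu>: "\<nu> > -2" using assms(2) by simp
  have \<delta>: "\<delta> (Suc j) > 0" if "j < N" for j using assms(3) that by simp
  have entry: "\<exists>c. \<forall>x::real. R_mat N a (K n) (P n) x $$ (i - 1, j - 1) =
        (if j \<le> n + i then of_real (poly (laguerre (n + i - j) (\<nu> + real j)) x) * c else 0)"
    if ij: "i \<in> {1..N}" "j \<in> {1..N}" for n i j
  proof -
    define L where "L = mat_inv (K n)"
    \<comment> \<open>row \<open>i\<close> of \<open>K\<^sup>-\<^sup>1 P\<close>, whose leading coefficient is row \<open>i\<close> of \<open>K\<^sup>-\<^sup>1\<close>\<close>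
    define u where "u = (\<lambda>k. \<Sum>l<N. smult (L $$ (i - 1, l)) (P n $$ (l, k)))"
    have i: "i - 1 < N" and j: "j - 1 < N" using ij by auto
    have monic: "monic_of_degree N n (P n)" and carrier: "P n \<in> carrier_mat N N"
      using assms(4) by (auto simp: monic_orthogonal_def monic_of_degree_def)
    have L: "L \<in> carrier_mat N N"
      using assms(5)[of n] mat_inv_unit_lower_triangular(1)
      by (auto simp: L_def diagonalizes_Gamma_def)
    have degree: "row_degree_less N (Suc n) u"
      unfolding row_degree_less_def
    proof (intro allI impI)
      fix k d assume "k < N" "Suc n \<le> d"
      hence "coeff (P n $$ (l, k)) d = 0" if "l < N" for l
        using monic that unfolding monic_of_degree_def by (meson Suc_le_lessD coeff_eq_0 le_less_trans)
      thus "coeff (u k) d = 0" by (simp add: u_def coeff_sum)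
    qed
    have lead: "coeff (u k) n = L $$ (i - 1, k)" if "k < N" for k
    proof -
      have "coeff (u k) n = (\<Sum>l<N. if l = k then L $$ (i - 1, k) else 0)"
        using monic_of_degree_coeff[OF monic] that unfolding u_def coeff_sum by (intro sum.cong) auto
      thus ?thesis using that by simp
    qed
    have row: "row_exp N a u = (\<lambda>j. \<Sum>l<N. smult (L $$ (i - 1, l)) (row_exp N a (poly_row (P n) l) j))"
      unfolding row_exp_smult row_exp_sum u_def ..
    have orthogonal: "row_inner N \<nu> \<delta> (row_exp N a u) (row_exp N a v) = 0"
      if "row_degree_less N n v" for v
      unfolding row row_inner_sum_left[OF \<nu>]
      using that by (simp add: orthogonal_to_lower_degree[OF \<nu> assms(4) _ order_refl])
    have "diag_op \<nu> (row_exp N a u) (j - 1) + smult (of_nat (n + i)) (row_exp N a u (j - 1)) = 0"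
    proof (rule diag_op_eigenfunction[OF \<nu> \<delta> degree orthogonal _ j])
      fix k assume "k < N"
      have "coeff (u k) (Suc n) = 0" using degree \<open>k < N\<close> by (simp add: row_degree_less_def)
      thus "coeff (row_op N a \<nu> u k) n + of_nat (n + i) * coeff (u k) n = 0"
        using mat_inv_Gamma_row[OF assms(5) i \<open>k < N\<close>, of n] ij \<open>k < N\<close>
        by (cases i; cases "Suc k < N") (auto simp: coeff_row_op lead L_def algebra_simps)
    qed
    moreover have "\<nu> + real (j - 1) + 1 = \<nu> + real j" "j - 1 + 1 = j" using ij by auto
    ultimately have "laguerre_op (\<nu> + real j) (row_exp N a u (j - 1)) - of_nat j * row_exp N a u (j - 1)
          + of_nat (n + i) * row_exp N a u (j - 1) = 0"
      by (simp only: diag_op_def of_nat_poly) simp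
    hence "laguerre_op (\<nu> + real j) (row_exp N a u (j - 1)) + of_nat (n + i) * row_exp N a u (j - 1)
          = of_nat j * row_exp N a u (j - 1)"
      by (simp add: algebra_simps)
    moreover have "\<nu> + real j > -1" using assms(2) by simp
    moreover have "R_mat N a (K n) (P n) x $$ (i - 1, j - 1) = poly (row_exp N a u (j - 1)) (of_real x)" for x
      unfolding u_def L_def by (rule R_mat_index[OF carrier L[unfolded L_def] i j])
    ultimately show ?thesis by (simp only: laguerre_op_eigenfunction)
  qed
  show ?thesis
    by (rule exI[of _ "\<lambda>n i j. SOME c. \<forall>x::real. R_mat N a (K n) (P n) x $$ (i - 1, j - 1) =
        (if j \<le> n + i then of_real (poly (laguerre (n + i - j) (\<nu> + real j)) x) * c else 0)"],
        intro allI ballI) (rule someI_ex[OF entry, THEN spec])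
qed

end
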